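(* Let $l\in\mathbb{N}-\frac12$ and let $\mathfrak{g}$ be the $l$-conformal Galilei algebra over $\mathbb{C}$. Then every 2-local derivation on $\mathfrak{g}$ is a derivation of $\mathfrak{g}$.
   Context: $\mathbb{N}$ denotes the positive integers, so $l\in\{\frac12,\frac32,\frac52,\dots\}$. The ($l$-)conformal Galilei algebra $\mathfrak{g}$ is the complex Lie algebra with basis $\{e,h,f,p_k,z\mid k=0,1,\dots,2l\}$ and Lie bracket determined by $[h,e]=2e$, $[h,f]=-2f$, $[e,f]=h$, $[h,p_k]=2(l-k)p_k$, $[e,p_k]=k\,p_{k-1}$, $[f,p_k]=(2l-k)p_{k+1}$, $[z,\mathfrak{g}]=0$, and $[p_k,p_{k'}]=\delta_{k+k',2l}(-1)^{k+l+\frac12}k!(2l-k)!\,z$ for $k,k'=0,1,\dots,2l$ (terms with coefficient $0$ are omitted). A derivation of $\mathfrak{g}$ is a linear map $D:\mathfrak{g}\to\mathfrak{g}$ with $D([x,y])=[D(x),y]+[x,D(y)]$ for all $x,y\in\mathfrak{g}$. A 2-local derivation on $\mathfrak{g}$ is a map $\Delta:\mathfrak{g}\to\mathfrak{g}$ (not assumed linear) such that for every $x,y\in\mathfrak{g}$ there is a derivation $\Delta_{x,y}$ of $\mathfrak{g}$ (depending on $x,y$) with $\Delta_{x,y}(x)=\Delta(x)$ and $\Delta_{x,y}(y)=\Delta(y)$. *)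

theory Defs
  imports Complex_Main
begin

locale lie_algebra = vector_space scale
  for scale :: "'k::field \<Rightarrow> 'g::ab_group_add \<Rightarrow> 'g"  (infixr \<open>*s\<close> 75) +
  fixes bracket :: "'g \<Rightarrow> 'g \<Rightarrow> 'g"
  assumes bracket_add_left: "bracket (x + y) w = bracket x w + bracket y w"
    and bracket_add_right: "bracket w (x + y) = bracket w x + bracket w y"
    and bracket_scale_left: "bracket (c *s x) y = c *s bracket x y"
    and bracket_scale_right: "bracket x (c *s y) = c *s bracket x y"
    and bracket_self: "bracket x x = 0"
    and jacobi: "bracket x (bracket y w) + bracket y (bracket w x) + bracket w (bracket x y) = 0"

definition derivation ::
  "('k::field \<Rightarrow> 'g::ab_group_add \<Rightarrow> 'g) \<Rightarrow> ('g \<Rightarrow> 'g \<Rightarrow> 'g) \<Rightarrow> ('g \<Rightarrow> 'g) \<Rightarrow> bool"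
  where "derivation scale bracket D \<longleftrightarrow>
    Vector_Spaces.linear scale scale D \<and>
    (\<forall>x y. D (bracket x y) = bracket (D x) y + bracket x (D y))"

definition two_local_derivation ::
  "('k::field \<Rightarrow> 'g::ab_group_add \<Rightarrow> 'g) \<Rightarrow> ('g \<Rightarrow> 'g \<Rightarrow> 'g) \<Rightarrow> ('g \<Rightarrow> 'g) \<Rightarrow> bool"
  where "two_local_derivation scale bracket \<Delta> \<longleftrightarrow>
    (\<forall>x y. \<exists>D. derivation scale bracket D \<and> D x = \<Delta> x \<and> D y = \<Delta> y)"

text \<open>
  The half-integer \<open>l\<close> is \<open>n - 1/2\<close> with \<open>n \<ge> 1\<close>, so that \<open>2l\<close> is the natural number \<open>2 * n - 1\<close>,
  \<open>l + 1/2\<close> is \<open>n\<close>, and \<open>p\<^sub>0, \<dots>, p\<^sub>2\<^sub>l\<close> are \<open>p 0, \<dots>, p (2 * n - 1)\<close>. The values of \<open>p\<close> beyond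
  \<open>2 * n - 1\<close> are irrelevant: \<open>p (k - 1)\<close> at \<open>k = 0\<close> and \<open>p (k + 1)\<close> at \<open>k = 2 * n - 1\<close> occur only
  with coefficient \<open>0\<close>. The brackets not listed follow from antisymmetry.
\<close>

locale conformal_galilei_algebra = lie_algebra scale bracket
  for scale :: "complex \<Rightarrow> 'g::ab_group_add \<Rightarrow> 'g"  (infixr \<open>*s\<close> 75)
    and bracket :: "'g \<Rightarrow> 'g \<Rightarrow> 'g" +
  fixes n :: nat and l :: complex
    and e h f z :: 'g and p :: "nat \<Rightarrow> 'g"
  assumes n_pos: "1 \<le> n"
    and l_eq: "l = of_nat n - 1 / 2"
    and basis_distinct: "distinct ([e, h, f, z] @ map p [0..<2 * n])"
    and basis_independent: "independent ({e, h, f, z} \<union> p ` {0..2 * n - 1})"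
    and basis_span: "span ({e, h, f, z} \<union> p ` {0..2 * n - 1}) = UNIV"
    and bracket_h_e: "bracket h e = 2 *s e"
    and bracket_h_f: "bracket h f = - 2 *s f"
    and bracket_e_f: "bracket e f = h"
    and bracket_h_p: "k \<le> 2 * n - 1 \<Longrightarrow> bracket h (p k) = (2 * (l - of_nat k)) *s p k"
    and bracket_e_p: "k \<le> 2 * n - 1 \<Longrightarrow> bracket e (p k) = of_nat k *s p (k - 1)"
    and bracket_f_p: "k \<le> 2 * n - 1 \<Longrightarrow> bracket f (p k) = (2 * l - of_nat k) *s p (k + 1)"
    and bracket_z: "bracket z x = 0"
    and bracket_p_p: "k \<le> 2 * n - 1 \<Longrightarrow> k' \<le> 2 * n - 1 \<Longrightarrow>
      bracket (p k) (p k') =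
        (if k + k' = 2 * n - 1 then ((-1) ^ (k + n) * fact k * fact (2 * n - 1 - k)) *s z else 0)"

end

theory Submission
  imports Defs
begin

text \<open>
  A derivation is determined by very few of its values, so a 2-local derivation can be compared with
  one derivation at a few well-chosen points. The points used are \<open>h + z\<close>, \<open>h + e + z\<close> and
  \<open>h + f + z\<close>. For \<open>t\<close> one of \<open>h\<close>, \<open>h + e\<close>, \<open>h + f\<close>, the derivations that vanish at \<open>t + z\<close> are
  exactly the multiples of \<open>[t, -]\<close>
  (\<open>derivation_vanishing_at_h_z\<close> and its two companions): \<open>t\<close> is a regular semisimple element of
  \<open>sl\<^sub>2\<close> that acts injectively on the span of the \<open>p\<^sub>k\<close>, because \<open>l\<close> is not an integer, and the
  summand \<open>z\<close> rules out the outer derivation, which scales every \<open>p\<^sub>k\<close> by 1 and \<open>z\<close> by 2.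

  Given a 2-local derivation, subtract a derivation that agrees with it at both \<open>h + z\<close> and
  \<open>h + e + z\<close>. The difference \<open>\<Delta>\<close> is again 2-local and vanishes at these two points. Hence
  \<open>\<Delta> x\<close> is a multiple of \<open>[h, x]\<close> and a multiple of \<open>[h + e, x]\<close>, for every \<open>x\<close>. At \<open>x = h + f + z\<close>
  these two brackets are independent, so \<open>\<Delta>\<close> vanishes there too, and \<open>\<Delta> x\<close> is also a multiple of
  \<open>[h + f, x]\<close>. If \<open>\<Delta> x\<close> were not 0, then \<open>[e, x]\<close> and \<open>[f, x]\<close> would both be multiples of
  \<open>[h, x]\<close>. As \<open>e\<close> raises and \<open>f\<close> lowers weights, this forces \<open>[h, x] = 0\<close>
  (\<open>bracket_h_eq_0\<close>), a contradiction. So \<open>\<Delta> = 0\<close>.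
\<close>

section \<open>Derivations of a Lie algebra\<close>

context lie_algebra
begin

lemma bracket_0_left [simp]: "bracket 0 x = 0"
  using bracket_add_left[of 0 0 x] by simp

lemma bracket_0_right [simp]: "bracket x 0 = 0"
  using bracket_add_right[of x 0 0] by simp

lemma bracket_minus_left: "bracket (- x) y = - bracket x y"
  using bracket_add_left[of x "- x" y] by (simp add: add_eq_0_iff)

lemma bracket_minus_right: "bracket y (- x) = - bracket y x"
  using bracket_add_right[of y x "- x"] by (simp add: add_eq_0_iff)

lemma bracket_diff_left: "bracket (x - y) w = bracket x w - bracket y w"
  using bracket_add_left[of x "- y" w] by (simp add: bracket_minus_left)

lemma bracket_diff_right: "bracket w (x - y) = bracket w x - bracket w y"
  using bracket_add_right[of w x "- y"] by (simp add: bracket_minus_right)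

lemma bracket_anticomm: "bracket y x = - bracket x y"
  using bracket_self[of "x + y"] bracket_self[of x] bracket_self[of y]
  by (simp only: bracket_add_left bracket_add_right eq_neg_iff_add_eq_0) simp

lemma derivation_iff:
  "derivation scale bracket D \<longleftrightarrow>
    (\<forall>x y. D (x + y) = D x + D y) \<and> (\<forall>c x. D (c *s x) = c *s D x) \<and>
    (\<forall>x y. D (bracket x y) = bracket (D x) y + bracket x (D y))"
  unfolding derivation_def Vector_Spaces.linear_iff using vector_space_axioms by auto

lemma derivation_scaled_inner: "derivation scale bracket (\<lambda>x. c *s bracket u x)"
proof -
  have "bracket u (bracket x y) = bracket (bracket u x) y + bracket x (bracket u y)" for x y
  proof -
    have "bracket x (bracket y u) = - bracket x (bracket u y)"
      using bracket_anticomm[of y u] by (simp only: bracket_minus_right)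
    then show ?thesis
      using jacobi[of u x y] bracket_anticomm[of y "bracket u x"] by (simp add: algebra_simps)
  qed
  then show ?thesis
    unfolding derivation_iff
    by (auto simp: bracket_add_right bracket_scale_right bracket_scale_left scale_right_distrib
        scale_left_commute)
qed

lemma derivation_diff:
  assumes "derivation scale bracket D" "derivation scale bracket D'"
  shows "derivation scale bracket (\<lambda>x. D x - D' x)"
  using assms unfolding derivation_iff
  by (auto simp: bracket_diff_left bracket_diff_right scale_right_diff_distrib)

lemma two_local_derivation_diff:
  assumes "two_local_derivation scale bracket \<Delta>" "derivation scale bracket D"
  shows "two_local_derivation scale bracket (\<lambda>x. \<Delta> x - D x)"
  unfolding two_local_derivation_def
proof (intro allI)
  fix x y
  obtain D' where "derivation scale bracket D'" "D' x = \<Delta> x" "D' y = \<Delta> y"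
    using assms(1) unfolding two_local_derivation_def by blast
  then show "\<exists>D'. derivation scale bracket D' \<and> D' x = \<Delta> x - D x \<and> D' y = \<Delta> y - D y"
    using derivation_diff[OF _ assms(2)] by (intro exI[of _ "\<lambda>x. D' x - D x"]) auto
qed

lemma derivation_preserves_center:
  assumes "derivation scale bracket D" "\<And>x. bracket c x = 0"
  shows "bracket (D c) x = 0"
proof -
  have "D (bracket c x) = bracket (D c) x + bracket c (D x)" "D 0 = 0"
    using assms(1) unfolding derivation_iff by (auto dest: spec[of _ 0])
  then show ?thesis by (simp add: assms(2))
qed

text \<open>
  If \<open>D (t + c) = 0\<close> with \<open>c\<close> central, then \<open>D t = - D c\<close> is central, so \<open>D\<close> commutes with \<open>[t, -]\<close>
  and preserves its eigenspaces.
\<close>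

lemma derivation_preserves_eigenspace:
  assumes D: "derivation scale bracket D"
    and c: "\<And>x. bracket c x = 0"
    and vanish: "D (t + c) = 0"
    and x: "bracket t x = w *s x"
  shows "bracket t (D x) = w *s D x"
proof -
  have add: "D (t + c) = D t + D c" and "D (w *s x) = w *s D x"
    and br: "D (bracket t x) = bracket (D t) x + bracket t (D x)"
    using D unfolding derivation_iff by blast+
  moreover have "bracket (D t) x = 0"
    using derivation_preserves_center[OF D c] add vanish
    by (simp add: add_eq_0_iff2 bracket_minus_left)
  ultimately show ?thesis using x by simp
qed

end

section \<open>Coordinates with respect to the standard basis\<close>

context conformal_galilei_algebra
begin

definition basis :: "'g set"
  where "basis = {e, h, f, z} \<union> p ` {..<2 * n}"

definition coord :: "'g \<Rightarrow> 'g \<Rightarrow> complex"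
  where "coord b x = representation basis x b"

text \<open>
  Indices beyond the last basis vector get the coordinate \<open>0\<close>, so that the formulas for the action
  of \<open>e\<close> and \<open>f\<close> hold at every index.
\<close>

definition coord_p :: "nat \<Rightarrow> 'g \<Rightarrow> complex"
  where "coord_p k x = (if k < 2 * n then coord (p k) x else 0)"

lemma atMost_eq: "{0..2 * n - 1} = {..<2 * n}"
  using n_pos by auto

lemma independent_basis: "independent basis"
  using basis_independent unfolding basis_def atMost_eq .

lemma span_basis: "span basis = UNIV"
  using basis_span unfolding basis_def atMost_eq .

lemma coord_add [simp]: "coord b (x + y) = coord b x + coord b y"
  and coord_scale [simp]: "coord b (c *s x) = c * coord b x"
  unfolding coord_def
  by (simp_all add: representation_add representation_scale independent_basis span_basis)

lemma coord_0 [simp]: "coord b 0 = 0"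
  using coord_add[of b 0 0] by simp

lemma coord_minus [simp]: "coord b (- x) = - coord b x"
  using coord_add[of b x "- x"] by (simp add: add_eq_0_iff)

lemma coord_diff [simp]: "coord b (x - y) = coord b x - coord b y"
  using coord_add[of b x "- y"] by simp

lemma coord_p_add [simp]: "coord_p k (x + y) = coord_p k x + coord_p k y"
  and coord_p_scale [simp]: "coord_p k (c *s x) = c * coord_p k x"
  and coord_p_0 [simp]: "coord_p k 0 = 0"
  and coord_p_minus [simp]: "coord_p k (- x) = - coord_p k x"
  and coord_p_diff [simp]: "coord_p k (x - y) = coord_p k x - coord_p k y"
  by (simp_all add: coord_p_def)

lemma coord_p_beyond [simp]: "2 * n \<le> k \<Longrightarrow> coord_p k x = 0"
  by (simp add: coord_p_def)

lemma basis_neq [simp]: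
  "e \<noteq> h" "e \<noteq> f" "e \<noteq> z" "h \<noteq> f" "h \<noteq> z" "f \<noteq> z"
  "h \<noteq> e" "f \<noteq> e" "z \<noteq> e" "f \<noteq> h" "z \<noteq> h" "z \<noteq> f"
  "k < 2 * n \<Longrightarrow> p k \<noteq> e" "k < 2 * n \<Longrightarrow> p k \<noteq> h" "k < 2 * n \<Longrightarrow> p k \<noteq> f" "k < 2 * n \<Longrightarrow> p k \<noteq> z"
  "k < 2 * n \<Longrightarrow> e \<noteq> p k" "k < 2 * n \<Longrightarrow> h \<noteq> p k" "k < 2 * n \<Longrightarrow> f \<noteq> p k" "k < 2 * n \<Longrightarrow> z \<noteq> p k"
proof -
  have "e \<notin> p ` {0..<2 * n}" "h \<notin> p ` {0..<2 * n}" "f \<notin> p ` {0..<2 * n}" "z \<notin> p ` {0..<2 * n}"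
    and "distinct [e, h, f, z]"
    using basis_distinct by simp_all
  moreover have "p k \<in> p ` {0..<2 * n}" if "k < 2 * n"
    using that by simp
  ultimately show
    "e \<noteq> h" "e \<noteq> f" "e \<noteq> z" "h \<noteq> f" "h \<noteq> z" "f \<noteq> z"
    "h \<noteq> e" "f \<noteq> e" "z \<noteq> e" "f \<noteq> h" "z \<noteq> h" "z \<noteq> f"
    "k < 2 * n \<Longrightarrow> p k \<noteq> e" "k < 2 * n \<Longrightarrow> p k \<noteq> h"
    "k < 2 * n \<Longrightarrow> p k \<noteq> f" "k < 2 * n \<Longrightarrow> p k \<noteq> z"
    "k < 2 * n \<Longrightarrow> e \<noteq> p k" "k < 2 * n \<Longrightarrow> h \<noteq> p k"
    "k < 2 * n \<Longrightarrow> f \<noteq> p k" "k < 2 * n \<Longrightarrow> z \<noteq> p k"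
    by (simp_all only: distinct.simps list.set insert_iff, metis+)
qed

lemma p_eq_iff [simp]:
  assumes "j < 2 * n" "k < 2 * n"
  shows "p j = p k \<longleftrightarrow> j = k"
proof -
  have "inj_on p {0..<2 * n}" using basis_distinct by (simp add: distinct_map)
  then show ?thesis using assms by (simp add: inj_on_eq_iff)
qed

lemma coord_basis:
  assumes "b \<in> basis" shows "coord c b = (if c = b then 1 else 0)"
  unfolding coord_def using representation_basis[OF independent_basis assms] by simp

lemma in_basis [simp]:
  "e \<in> basis" "h \<in> basis" "f \<in> basis" "z \<in> basis" "k < 2 * n \<Longrightarrow> p k \<in> basis"
  by (auto simp: basis_def)

lemma coord_p_basis [simp]:
  "coord_p k e = 0" "coord_p k h = 0" "coord_p k f = 0" "coord_p k z = 0"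
  "j < 2 * n \<Longrightarrow> coord_p k (p j) = (if k = j then 1 else 0)"
  by (auto simp: coord_p_def coord_basis)

lemma eq_by_coordsI:
  assumes "coord e x = coord e y" "coord h x = coord h y" "coord f x = coord f y"
    "coord z x = coord z y" "\<And>k. coord_p k x = coord_p k y"
  shows "x = y"
proof -
  have "representation basis x b = representation basis y b" for b
  proof (cases "b \<in> basis")
    case True
    then consider "b \<in> {e, h, f, z}" | k where "k < 2 * n" "b = p k"
      unfolding basis_def by blast
    then show ?thesis
    proof cases
      case 1
      then show ?thesis using assms(1-4) unfolding coord_def by blast
    next
      case 2
      then show ?thesis using assms(5)[of k] by (simp add: coord_p_def coord_def)
    qed
  next
    case False
    then show ?thesis using representation_ne_zero by metis
  qed
  then have "representation basis x = representation basis y" by blast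
  then show ?thesis
    using sum_nonzero_representation_eq[OF independent_basis] span_basis by (metis UNIV_I)
qed

lemma linear_functional_eqI:
  fixes \<phi> \<psi> :: "'g \<Rightarrow> complex"
  assumes "\<And>x y. \<phi> (x + y) = \<phi> x + \<phi> y" "\<And>c x. \<phi> (c *s x) = c * \<phi> x"
    and "\<And>x y. \<psi> (x + y) = \<psi> x + \<psi> y" "\<And>c x. \<psi> (c *s x) = c * \<psi> x"
    and "\<phi> e = \<psi> e" "\<phi> h = \<psi> h" "\<phi> f = \<psi> f" "\<phi> z = \<psi> z" "\<And>k. k < 2 * n \<Longrightarrow> \<phi> (p k) = \<psi> (p k)"
  shows "\<forall>x. \<phi> x = \<psi> x"
proof -
  have "\<phi> 0 = \<psi> 0" using assms(2,4)[of 0 0] by simp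
  then have "subspace {x. \<phi> x = \<psi> x}"
    using assms(1-4) by (auto simp: subspace_def)
  moreover have "basis \<subseteq> {x. \<phi> x = \<psi> x}"
    using assms(5-) by (auto simp: basis_def)
  ultimately have "span basis \<subseteq> {x. \<phi> x = \<psi> x}" by (rule span_minimal[rotated])
  then show ?thesis using span_basis by auto
qed

lemma linear_map_eqI:
  fixes A B :: "'g \<Rightarrow> 'g"
  assumes "\<And>x y. A (x + y) = A x + A y" "\<And>c x. A (c *s x) = c *s A x"
    and "\<And>x y. B (x + y) = B x + B y" "\<And>c x. B (c *s x) = c *s B x"
    and "A e = B e" "A h = B h" "A f = B f" "A z = B z" "\<And>k. k < 2 * n \<Longrightarrow> A (p k) = B (p k)"
  shows "\<forall>x. A x = B x"
proof -
  have "\<forall>x. coord b (A x) = coord b (B x)" for b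
    by (rule linear_functional_eqI) (simp_all add: assms)
  moreover have "\<forall>x. coord_p k (A x) = coord_p k (B x)" for k
    by (rule linear_functional_eqI) (simp_all add: assms)
  ultimately show ?thesis by (auto intro: eq_by_coordsI)
qed

section \<open>The action of \<open>sl\<^sub>2\<close> in coordinates\<close>

lemma two_l: "2 * l = of_nat (2 * n - 1)"
  using n_pos by (simp add: l_eq of_nat_diff)

text \<open>Half-integrality of \<open>l\<close>: the weights of the \<open>p\<^sub>k\<close> are odd, unlike those of \<open>sl\<^sub>2\<close> and \<open>z\<close>.\<close>

lemma weight_p_not_even: "2 * (l - of_nat k) \<noteq> 2 * of_int i"
proof
  assume "2 * (l - of_nat k) = 2 * of_int i"
  then have "of_int (2 * int n - 1 - 2 * int k) = (of_int (2 * i) :: complex)"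
    by (simp add: l_eq algebra_simps)
  then have "2 * int n - 1 - 2 * int k = 2 * i" by (simp only: of_int_eq_iff)
  then show False by presburger
qed

lemma weight_p_neq [simp]:
  "2 * (l - of_nat k) \<noteq> 0" "2 * (l - of_nat k) \<noteq> 2" "2 * (l - of_nat k) \<noteq> - 2"
  using weight_p_not_even[of k 0] weight_p_not_even[of k 1] weight_p_not_even[of k "-1"] by auto

lemma bracket_sl2 [simp]:
  "bracket h h = 0" "bracket h e = 2 *s e" "bracket h f = - (2 *s f)" "bracket h z = 0"
  "bracket e h = - (2 *s e)" "bracket e e = 0" "bracket e f = h" "bracket e z = 0"
  "bracket f h = 2 *s f" "bracket f e = - h" "bracket f f = 0" "bracket f z = 0"
  using bracket_h_e bracket_h_f bracket_e_f bracket_z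
    bracket_anticomm[of e h] bracket_anticomm[of f h] bracket_anticomm[of f e]
    bracket_anticomm[of h z] bracket_anticomm[of e z] bracket_anticomm[of f z]
  by (simp_all add: bracket_self)

lemma bracket_sl2_p [simp]:
  assumes "k < 2 * n"
  shows "bracket h (p k) = (2 * (l - of_nat k)) *s p k"
    and "bracket e (p k) = of_nat k *s p (k - 1)"
    and "bracket f (p k) = (2 * l - of_nat k) *s p (k + 1)"
  using assms bracket_h_p bracket_e_p bracket_f_p by auto

lemma coord_bracket_h [rule_format]:
  "\<forall>x. coord e (bracket h x) = 2 * coord e x"
  "\<forall>x. coord h (bracket h x) = 0"
  "\<forall>x. coord f (bracket h x) = - 2 * coord f x"
  "\<forall>x. coord z (bracket h x) = 0"
  "\<forall>x. coord_p k (bracket h x) = 2 * (l - of_nat k) * coord_p k x"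
  by (rule linear_functional_eqI;
      simp add: bracket_add_right bracket_scale_right coord_basis algebra_simps)+

lemma coord_bracket_e [rule_format]:
  "\<forall>x. coord e (bracket e x) = - 2 * coord h x"
  "\<forall>x. coord h (bracket e x) = coord f x"
  "\<forall>x. coord f (bracket e x) = 0"
  "\<forall>x. coord z (bracket e x) = 0"
  "\<forall>x. coord_p k (bracket e x) = of_nat (Suc k) * coord_p (Suc k) x"
  by (rule linear_functional_eqI;
      auto simp add: bracket_add_right bracket_scale_right coord_basis algebra_simps)+

lemma coord_bracket_f [rule_format]:
  "\<forall>x. coord e (bracket f x) = 0"
  "\<forall>x. coord h (bracket f x) = - coord e x"
  "\<forall>x. coord f (bracket f x) = 2 * coord h x"
  "\<forall>x. coord z (bracket f x) = 0"
  "\<forall>x. coord_p 0 (bracket f x) = 0"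
  "\<forall>x. coord_p (Suc k) (bracket f x) = (2 * l - of_nat k) * coord_p k x"
proof -
  \<comment> \<open>The vector \<open>p (2 * n)\<close> is arbitrary, but its coefficient in \<open>bracket f (p (2 * n - 1))\<close> is 0.\<close>
  have fp: "bracket f (p j) = (if j = 2 * n - 1 then 0 else (2 * l - of_nat j) *s p (Suc j))"
    if "j < 2 * n" for j
    using that by (auto simp: two_l)
  have last: "2 * l - of_nat j = 0" if "j < 2 * n" "\<not> Suc j < 2 * n" for j
  proof -
    from that have "j = 2 * n - 1" by simp
    then show ?thesis by (simp add: two_l)
  qed
  note [simp del] = bracket_sl2_p(3)
  note lin = bracket_add_right bracket_scale_right coord_basis fp
  show "\<forall>x. coord e (bracket f x) = 0"
    by (rule linear_functional_eqI; auto simp: lin algebra_simps)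
  show "\<forall>x. coord h (bracket f x) = - coord e x"
    by (rule linear_functional_eqI; auto simp: lin algebra_simps)
  show "\<forall>x. coord f (bracket f x) = 2 * coord h x"
    by (rule linear_functional_eqI; auto simp: lin algebra_simps)
  show "\<forall>x. coord z (bracket f x) = 0"
    by (rule linear_functional_eqI; auto simp: lin algebra_simps)
  show "\<forall>x. coord_p 0 (bracket f x) = 0"
    by (rule linear_functional_eqI; auto simp: lin algebra_simps)
  show "\<forall>x. coord_p (Suc k) (bracket f x) = (2 * l - of_nat k) * coord_p k x"
    by (rule linear_functional_eqI; auto simp: lin last l_eq algebra_simps)
qed

lemmas coord_bracket = coord_bracket_h coord_bracket_e coord_bracket_f

text \<open>
  The \<open>e\<close>- and \<open>f\<close>-coordinates of \<open>x\<close> appear as the \<open>h\<close>-coordinates of \<open>[f, x]\<close> and \<open>[e, x]\<close>, and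
  \<open>[h, x]\<close> has no \<open>h\<close>-coordinate, so they vanish. The part of \<open>x\<close> in the span of the
  \<open>p\<^sub>k\<close> vanishes because \<open>h\<close> is diagonal and invertible there, whereas \<open>e\<close> and \<open>f\<close> are strictly
  triangular in opposite directions: the first relation leaves only a multiple of \<open>p\<^sub>0\<close>, which the
  second one excludes.
\<close>

lemma bracket_h_eq_0:
  assumes e: "bracket e x = a *s bracket h x" and f: "bracket f x = b *s bracket h x"
  shows "bracket h x = 0"
proof -
  have E: "coord e x = 0" using arg_cong[OF f, of "coord h"] by (simp add: coord_bracket)
  have F: "coord f x = 0" using arg_cong[OF e, of "coord h"] by (simp add: coord_bracket)
  have up: "of_nat (Suc k) * coord_p (Suc k) x = a * (2 * (l - of_nat k) * coord_p k x)" for k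
    using arg_cong[OF e, of "coord_p k"] by (simp add: coord_bracket del: of_nat_Suc)
  have P_Suc: "coord_p (Suc k) x = 0" for k
  proof (cases "a = 0")
    case True
    then show ?thesis using up[of k] by (simp del: of_nat_Suc)
  next
    case False
    have "coord_p j x = 0" for j
    proof (cases "j \<le> 2 * n")
      case True
      then show ?thesis
      proof (induction j rule: inc_induct)
        case (step j)
        then show ?case using up[of j] False weight_p_neq(1)[of j] by simp
      qed simp
    qed simp
    then show ?thesis .
  qed
  have P_0: "coord_p 0 x = 0"
  proof (cases "b = 0")
    case True
    have "l \<noteq> 0" using weight_p_neq(1)[of 0] by simp
    then show ?thesis
      using arg_cong[OF f, of "coord_p (Suc 0)"] True by (simp add: coord_bracket)
  next
    case False
    then show ?thesis
      using arg_cong[OF f, of "coord_p 0"] weight_p_neq(1)[of 0] by (simp add: coord_bracket)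
  qed
  have "coord_p k x = 0" for k using P_Suc P_0 by (cases k) auto
  then show ?thesis using E F by (intro eq_by_coordsI) (simp_all add: coord_bracket)
qed

text \<open>
  Weights of \<open>sl\<^sub>2\<close> and \<open>z\<close> are even and those of the \<open>p\<^sub>k\<close> are odd and pairwise distinct, so no
  other basis vector has the weight of \<open>p\<^sub>k\<close>.
\<close>

lemma eigenvector_h_p:
  assumes "bracket h x = (2 * (l - of_nat k)) *s x" "k < 2 * n"
  shows "x = coord_p k x *s p k"
proof (rule eq_by_coordsI)
  note eq = arg_cong[OF assms(1)]
  show "coord e x = coord e (coord_p k x *s p k)"
    using eq[of "coord e"] weight_p_neq(2)[of k] assms(2) by (auto simp: coord_bracket coord_basis)
  show "coord h x = coord h (coord_p k x *s p k)"
    using eq[of "coord h"] weight_p_neq(1)[of k] assms(2) by (auto simp: coord_bracket coord_basis)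
  show "coord f x = coord f (coord_p k x *s p k)"
    using eq[of "coord f"] weight_p_neq(3)[of k] assms(2)
    by (auto simp: coord_bracket coord_basis simp flip: mult_minus_left)
  show "coord z x = coord z (coord_p k x *s p k)"
    using eq[of "coord z"] weight_p_neq(1)[of k] assms(2) by (auto simp: coord_bracket coord_basis)
  show "coord_p j x = coord_p j (coord_p k x *s p k)" for j
    using eq[of "coord_p j"] assms(2) by (auto simp: coord_bracket)
qed

text \<open>
  On the span of the \<open>p\<^sub>k\<close> the operator is triangular with the odd weights of \<open>h\<close> on its diagonal, so
  the even eigenvalue \<open>2\<close> does not occur there. The case \<open>c = 0\<close> is the weight space of \<open>h\<close> itself.
\<close>

lemma eigenvector_h_plus_e:
  assumes "bracket (h + c *s e) x = 2 *s x"
  shows "x = coord e x *s e"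
proof (rule eq_by_coordsI)
  have eq: "bracket h x + c *s bracket e x = 2 *s x"
    using assms by (simp add: bracket_add_left bracket_scale_left)
  note eq = arg_cong[OF eq]
  have F: "coord f x = 0"
    using eq[of "coord f"] by (simp add: coord_bracket)
  show "coord f x = coord f (coord e x *s e)"
    using F by (simp add: coord_basis)
  show "coord h x = coord h (coord e x *s e)"
    using eq[of "coord h"] F by (simp add: coord_bracket coord_basis)
  show "coord z x = coord z (coord e x *s e)"
    using eq[of "coord z"] by (simp add: coord_bracket coord_basis)
  show "coord e x = coord e (coord e x *s e)"
    by (simp add: coord_basis)
  have "coord_p j x = 0" if "j \<le> 2 * n" for j
    using that
  proof (induction j rule: inc_induct)
    case (step j)
    then show ?case using eq[of "coord_p j"] weight_p_neq(2)[of j] by (auto simp: coord_bracket)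
  qed simp
  then show "coord_p j x = coord_p j (coord e x *s e)" for j
    by (cases "j \<le> 2 * n") auto
qed

lemma eigenvector_h_plus_f:
  assumes "bracket (h + c *s f) x = (- 2) *s x"
  shows "x = coord f x *s f"
proof (rule eq_by_coordsI)
  have eq: "bracket h x + c *s bracket f x = (- 2) *s x"
    using assms by (simp add: bracket_add_left bracket_scale_left)
  note eq = arg_cong[OF eq]
  have E: "coord e x = 0"
    using eq[of "coord e"] by (simp add: coord_bracket)
  show "coord e x = coord e (coord f x *s f)"
    using E by (simp add: coord_basis)
  show "coord h x = coord h (coord f x *s f)"
    using eq[of "coord h"] E by (simp add: coord_bracket coord_basis)
  show "coord z x = coord z (coord f x *s f)"
    using eq[of "coord z"] by (simp add: coord_bracket coord_basis)
  show "coord f x = coord f (coord f x *s f)"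
    by (simp add: coord_basis)
  have "coord_p j x = 0" for j
  proof (induction j)
    case 0
    then show ?case using eq[of "coord_p 0"] weight_p_neq(3)[of 0]
      by (auto simp: coord_bracket simp flip: mult_minus_left)
  next
    case (Suc j)
    then show ?case using eq[of "coord_p (Suc j)"] weight_p_neq(3)[of "Suc j"]
      by (auto simp: coord_bracket simp flip: mult_minus_left)
  qed
  then show "coord_p j x = coord_p j (coord f x *s f)" for j by simp
qed

section \<open>Derivations that vanish at \<open>h + z\<close>, \<open>h + e + z\<close> or \<open>h + f + z\<close>\<close>

text \<open>
  The derivation preserves the weight spaces of \<open>h\<close>, so it is diagonal in the standard basis. The
  brackets \<open>[e, f]\<close> and \<open>[e, p\<^sub>k]\<close> leave only a multiple of \<open>[h, -]\<close> and a common shift of the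
  eigenvalues on the \<open>p\<^sub>k\<close>, and the bracket \<open>[p\<^sub>0, p\<^sub>2\<^sub>l]\<close>, a nonzero multiple of \<open>z\<close>, excludes the shift once \<open>z\<close> is known to be killed.
\<close>

lemma derivation_vanishing_at_h_z:
  assumes D: "derivation scale bracket D" and vanish: "D (h + z) = 0"
  obtains a where "\<And>x. D x = a *s bracket h x"
proof -
  have D_add: "D (x + y) = D x + D y" and D_scale: "D (c *s x) = c *s D x"
    and D_br: "D (bracket x y) = bracket (D x) y + bracket x (D y)" for x y c
    using D unfolding derivation_iff by blast+
  note eig = derivation_preserves_eigenspace[OF D bracket_z vanish]
  have "bracket (h + 0 *s e) (D e) = 2 *s D e" using eig[of e 2] by simp
  then obtain a where De: "D e = a *s e" using eigenvector_h_plus_e by metis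
  have "bracket (h + 0 *s f) (D f) = (- 2) *s D f" using eig[of f "- 2"] by simp
  then obtain b where Df: "D f = b *s f" using eigenvector_h_plus_f by metis
  have Dh: "D h = (a + b) *s h"
    using D_br[of e f] by (simp add: De Df bracket_scale_left bracket_scale_right
        scale_left_distrib)
  have "D h = - D z" using vanish by (simp add: D_add add_eq_0_iff2)
  then have "bracket (D h) e = 0"
    using derivation_preserves_center[OF D bracket_z] by (simp add: bracket_minus_left)
  then have "coord e (bracket (D h) e) = 0" by simp
  then have "2 * (a + b) = 0" by (simp add: Dh bracket_scale_left coord_basis mult.commute)
  then have ab: "a + b = 0" by (simp only: mult_eq_0_iff) simp
  have Dh0: "D h = 0" and Dz0: "D z = 0" using Dh ab \<open>D h = - D z\<close> by simp_all
  have "\<exists>d. D (p k) = d *s p k" if "k < 2 * n" for k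
    using eigenvector_h_p[OF eig[of "p k" "2 * (l - of_nat k)"] that] that by auto
  then obtain d where d: "\<And>k. k < 2 * n \<Longrightarrow> D (p k) = d k *s p k" by metis
  have d_Suc: "d (Suc k) = d k - a" if k: "Suc k < 2 * n" for k
  proof -
    have "of_nat (Suc k) *s (d k *s p k) =
        a *s (of_nat (Suc k) *s p k) + d (Suc k) *s (of_nat (Suc k) *s p k)"
      using D_br[of e "p (Suc k)"] k
      by (simp add: De d D_scale bracket_scale_left bracket_scale_right del: of_nat_Suc)
    from arg_cong[OF this, of "coord_p k"] k
    have "of_nat (Suc k) * d k = of_nat (Suc k) * (a + d (Suc k))"
      by (simp add: algebra_simps del: of_nat_Suc)
    then show ?thesis by (simp del: of_nat_Suc)
  qed
  have d_k: "d k = d 0 - of_nat k * a" if "k < 2 * n" for k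
    using that by (induction k) (auto simp: d_Suc algebra_simps)
  have "d 0 + d (2 * n - 1) = 0"
  proof -
    define \<gamma> :: complex where "\<gamma> = (-1) ^ n * fact (2 * n - 1)"
    have br: "bracket (p 0) (p (2 * n - 1)) = \<gamma> *s z"
      using bracket_p_p[of 0 "2 * n - 1"] by (simp add: \<gamma>_def)
    have "\<gamma> *s D z = d 0 *s (\<gamma> *s z) + d (2 * n - 1) *s (\<gamma> *s z)"
      using D_br[of "p 0" "p (2 * n - 1)"] d[of 0] d[of "2 * n - 1"] n_pos
      by (simp add: br[simplified] D_scale bracket_scale_left bracket_scale_right)
    from arg_cong[OF this, of "coord z"] have "\<gamma> * (d 0 + d (2 * n - 1)) = 0"
      by (simp add: Dz0 coord_basis algebra_simps)
    then show ?thesis by (simp add: \<gamma>_def)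
  qed
  moreover have "d (2 * n - 1) = d 0 - 2 * l * a"
    using d_k[of "2 * n - 1"] n_pos unfolding two_l by simp
  ultimately have "2 * d 0 = 2 * l * a" by simp
  then have d_eq: "d k = (a / 2) * (2 * (l - of_nat k))" if "k < 2 * n" for k
    using d_k[OF that] by (simp add: algebra_simps)
  have "\<forall>x. D x = (a / 2) *s bracket h x"
  proof (rule linear_map_eqI)
    show "D f = (a / 2) *s bracket h f"
      using ab by (simp add: Df add_eq_0_iff)
    show "D (p k) = (a / 2) *s bracket h (p k)" if "k < 2 * n" for k
      using that by (simp add: d d_eq)
  qed (simp_all add: D_add D_scale De Dh0 Dz0 bracket_add_right bracket_scale_right
      scale_right_distrib mult.commute)
  then show thesis using that by blast
qed

text \<open>
  Since \<open>e\<close> spans an eigenspace of \<open>[h + e, -]\<close>, subtracting a multiple of \<open>[h + e, -]\<close> makes the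
  derivation vanish at \<open>e\<close>, hence at \<open>h + z\<close>; it is then a multiple of \<open>[h, -]\<close> that kills \<open>e\<close>.
\<close>

lemma derivation_vanishing_at_h_e_z:
  assumes D: "derivation scale bracket D" and vanish: "D (h + e + z) = 0"
  obtains a where "\<And>x. D x = a *s bracket (h + e) x"
proof -
  have "bracket (h + e) (D e) = 2 *s D e"
    using derivation_preserves_eigenspace[OF D bracket_z vanish, of e 2]
    by (simp add: bracket_add_left)
  then obtain a where De: "D e = a *s e" using eigenvector_h_plus_e[of 1] by auto
  define D' where "D' x = D x - (a / 2) *s bracket (h + e) x" for x
  have D': "derivation scale bracket D'"
    unfolding D'_def by (intro derivation_diff D derivation_scaled_inner)
  have "D' (h + e + z) = D' (h + z) + D' e"
    using D' unfolding derivation_iff by (metis add.commute add.left_commute)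
  moreover have e: "D' e = 0" by (simp add: D'_def De bracket_add_left)
  moreover have "D' (h + e + z) = 0"
    by (simp add: D'_def vanish bracket_add_left bracket_add_right)
  ultimately have "D' (h + z) = 0" by simp
  from derivation_vanishing_at_h_z[OF D' this] obtain b where b: "\<And>x. D' x = b *s bracket h x"
    by blast
  have "coord e (D' e) = 0" by (simp add: e)
  then have "b = 0" by (simp add: b coord_basis)
  then have "D x = (a / 2) *s bracket (h + e) x" for x using b[of x] by (simp add: D'_def)
  then show thesis by (rule that)
qed

lemma derivation_vanishing_at_h_f_z:
  assumes D: "derivation scale bracket D" and vanish: "D (h + f + z) = 0"
  obtains a where "\<And>x. D x = a *s bracket (h + f) x"
proof -
  have "bracket (h + f) (D f) = (- 2) *s D f"
    using derivation_preserves_eigenspace[OF D bracket_z vanish, of f "- 2"]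
    by (simp add: bracket_add_left)
  then obtain a where Df: "D f = a *s f" using eigenvector_h_plus_f[of 1] by auto
  define D' where "D' x = D x - (- a / 2) *s bracket (h + f) x" for x
  have D': "derivation scale bracket D'"
    unfolding D'_def by (intro derivation_diff D derivation_scaled_inner)
  have "D' (h + f + z) = D' (h + z) + D' f"
    using D' unfolding derivation_iff by (metis add.commute add.left_commute)
  moreover have f: "D' f = 0" by (simp add: D'_def Df bracket_add_left)
  moreover have "D' (h + f + z) = 0"
    by (simp add: D'_def vanish bracket_add_left bracket_add_right)
  ultimately have "D' (h + z) = 0" by simp
  from derivation_vanishing_at_h_z[OF D' this] obtain b where b: "\<And>x. D' x = b *s bracket h x"
    by blast
  have "coord f (D' f) = 0" by (simp add: f)
  then have "b = 0" by (simp add: b coord_basis)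
  then have "D x = (- a / 2) *s bracket (h + f) x" for x
    using b[of x] unfolding D'_def by (simp only: scale_zero_left right_minus_eq)
  then show thesis by (rule that)
qed

section \<open>2-local derivations\<close>

lemma two_local_derivation_eq_0:
  assumes \<Delta>: "two_local_derivation scale bracket \<Delta>"
    and h: "\<Delta> (h + z) = 0" and he: "\<Delta> (h + e + z) = 0"
  shows "\<Delta> x = 0"
proof -
  have multiple_h: "\<exists>a. \<Delta> y = a *s bracket h y" for y
    using \<Delta> h derivation_vanishing_at_h_z unfolding two_local_derivation_def by metis
  have multiple_he: "\<exists>a. \<Delta> y = a *s bracket (h + e) y" for y
    using \<Delta> he derivation_vanishing_at_h_e_z unfolding two_local_derivation_def by metis
  have "\<Delta> (h + f + z) = 0"
  proof -
    obtain a b where ab: "\<Delta> (h + f + z) = a *s bracket h (h + f + z)"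
      "\<Delta> (h + f + z) = b *s bracket (h + e) (h + f + z)"
      using multiple_h multiple_he by metis
    then have "coord h (a *s bracket h (h + f + z)) = coord h (b *s bracket (h + e) (h + f + z))"
      by simp
    then have "b = 0"
      by (simp add: bracket_add_left bracket_add_right coord_basis)
    then show ?thesis using ab by simp
  qed
  then have multiple_hf: "\<exists>a. \<Delta> y = a *s bracket (h + f) y" for y
    using \<Delta> derivation_vanishing_at_h_f_z unfolding two_local_derivation_def by metis
  obtain a where a: "\<Delta> x = a *s bracket h x" using multiple_h by blast
  have parallel: "\<exists>c. bracket t x = c *s bracket h x"
    if nz: "\<Delta> x \<noteq> 0" and mult: "\<exists>b. \<Delta> x = b *s bracket (h + t) x" for t
  proof -
    obtain b where b: "\<Delta> x = b *s bracket h x + b *s bracket t x"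
      using mult by (auto simp: bracket_add_left scale_right_distrib)
    have "b \<noteq> 0" using b nz by auto
    have "b *s bracket t x = (a - b) *s bracket h x"
      using a b by (simp add: scale_left_diff_distrib algebra_simps)
    then have "inverse b *s (b *s bracket t x) = inverse b *s ((a - b) *s bracket h x)" by simp
    then show ?thesis using \<open>b \<noteq> 0\<close> by auto
  qed
  show ?thesis
  proof (rule ccontr)
    assume "\<Delta> x \<noteq> 0"
    then have "bracket h x = 0"
      using parallel multiple_he multiple_hf bracket_h_eq_0 by metis
    with a \<open>\<Delta> x \<noteq> 0\<close> show False by simp
  qed
qed

lemma derivation_if_two_local_derivation:
  assumes \<Delta>: "two_local_derivation scale bracket \<Delta>"
  shows "derivation scale bracket \<Delta>"
proof -
  obtain D where D: "derivation scale bracket D"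
    and eq: "D (h + z) = \<Delta> (h + z)" "D (h + e + z) = \<Delta> (h + e + z)"
    using \<Delta> unfolding two_local_derivation_def by blast
  have "\<Delta> x - D x = 0" for x
    by (rule two_local_derivation_eq_0[OF two_local_derivation_diff[OF \<Delta> D]]) (simp_all add: eq)
  then have "\<Delta> = D" by auto
  with D show ?thesis by simp
qed

end

theorem theorem3p6:
  fixes scale :: "complex \<Rightarrow> 'g::ab_group_add \<Rightarrow> 'g"
    and bracket :: "'g \<Rightarrow> 'g \<Rightarrow> 'g"
    and n :: nat and l :: complex
    and e h f z :: 'g and p :: "nat \<Rightarrow> 'g"
    and \<Delta> :: "'g \<Rightarrow> 'g"
  assumes "conformal_galilei_algebra scale bracket n l e h f z p"
    and "two_local_derivation scale bracket \<Delta>"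
  shows "derivation scale bracket \<Delta>"
  by (rule conformal_galilei_algebra.derivation_if_two_local_derivation[OF assms])

end
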